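(* We have that $$p(n)=n+\nu(n)-1+\sum_{\mu\in \mathcal N_n\setminus (n)}(\mu_1-\mu_2),$$ with the right-hand sum taken over nuclear partitions $\mu=(\mu_1,\mu_2,\dots,\mu_r)$ of $n$ apart from the partition $(n)$.
   Context: $p(n)$ denotes the partition function, i.e. the number of integer partitions of $n\geq 0$, where $p(0):=1$. A nuclear partition is an integer partition having no part equal to one. $\mathcal N_n$ denotes the set of nuclear partitions of $n\geq 0$, and $(n)$ denotes the partition of $n$ into just one part; $\mathcal N_n\setminus (n)$ is the set of nuclear partitions of $n$ aside from $(n)$. For $n\geq 1$, $\nu(n)$ counts the number of nuclear partitions of $n$, with $\nu(0):=1$ (and $\nu(1)=0$). A nuclear partition is written $\mu=(\mu_1,\mu_2,\dots,\mu_r)$ with $\mu_1\geq\mu_2\geq\dots\geq\mu_r\geq 2$.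
   Formalization: The identity is stated for n ≥ 2: at n = 1 it would read 1 = 0, and at n = 0 the term μ₁ − μ₂ is undefined for the empty partition (read as 0, it again gives 1 = 0). *)

theory Defs
  imports Main
begin

(* A partition of n is the weakly decreasing list [mu_1, ..., mu_r] of its positive parts.
   The empty list is the unique partition of 0. *)
definition partitions :: "nat \<Rightarrow> nat list set" where
  "partitions n = {\<mu>. sorted_wrt (\<ge>) \<mu> \<and> (\<forall>k\<in>set \<mu>. 0 < k) \<and> sum_list \<mu> = n}"

definition p :: "nat \<Rightarrow> nat" where
  "p n = card (partitions n)"

definition nuclear_partitions :: "nat \<Rightarrow> nat list set" where
  "nuclear_partitions n = {\<mu> \<in> partitions n. 1 \<notin> set \<mu>}"

definition \<nu> :: "nat \<Rightarrow> nat" where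
  "\<nu> n = card (nuclear_partitions n)"

lemma finite_partitions: "finite (partitions n)"
proof (rule finite_subset)
  show "partitions n \<subseteq> {\<mu>. set \<mu> \<subseteq> {..n} \<and> length \<mu> \<le> n}"
  proof
    fix \<mu> assume "\<mu> \<in> partitions n"
    then have pos: "\<forall>k\<in>set \<mu>. 0 < k" and sum: "sum_list \<mu> = n"
      by (auto simp: partitions_def)
    have "length \<mu> \<le> sum_list \<mu>"
      using pos by (induction \<mu>) auto
    then show "\<mu> \<in> {\<mu>. set \<mu> \<subseteq> {..n} \<and> length \<mu> \<le> n}"
      using sum member_le_sum_list by auto
  qed
  show "finite {\<mu>. set \<mu> \<subseteq> {..n} \<and> length \<mu> \<le> n}"
    by (rule finite_lists_length_le) simp
qed

lemma finite_nuclear_partitions: "finite (nuclear_partitions n)"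
  by (rule finite_subset[OF _ finite_partitions]) (auto simp: nuclear_partitions_def)

lemma partitions_0: "partitions 0 = {[]}"
proof -
  have "\<mu> = []" if "\<mu> \<in> partitions 0" for \<mu>
    using that by (cases \<mu>) (auto simp: partitions_def)
  then show ?thesis by (auto simp: partitions_def)
qed

lemma p_0: "p 0 = 1"
  by (simp add: p_def partitions_0)

lemma \<nu>_0: "\<nu> 0 = 1"
proof -
  have "nuclear_partitions 0 = {[]}"
    by (auto simp: nuclear_partitions_def partitions_0)
  then show ?thesis by (simp add: \<nu>_def)
qed

lemma \<nu>_1: "\<nu> 1 = 0"
proof -
  have "\<mu> \<notin> nuclear_partitions 1" for \<mu>
    by (cases \<mu>) (auto simp: nuclear_partitions_def partitions_def add_is_1)
  then have "nuclear_partitions 1 = {}" by blast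
  then show ?thesis by (simp add: \<nu>_def)
qed

end

theory Submission
  imports Defs
begin

text \<open>
  A partition \<open>\<rho>\<^sub>1 \<ge> \<dots> \<ge> \<rho>\<^sub>r\<close> with \<open>k \<ge> 1\<close> ones behind its first part becomes nuclear when these ones
  are absorbed into the first part. Conversely, from a nuclear partition \<open>\<mu>\<close> one can
  split off \<open>k\<close> ones from \<open>\<mu>\<^sub>1\<close> for every \<open>1 \<le> k \<le> \<mu>\<^sub>1 - \<mu>\<^sub>2\<close>. With the convention \<open>\<mu>\<^sub>2 = 1\<close> for
  \<open>\<mu> = (n)\<close> this also covers \<open>(1, \<dots>, 1)\<close>, and \<open>(n)\<close> accounts for \<open>n - 1\<close> partitions.
\<close>

definition split_ones :: "nat list \<times> nat \<Rightarrow> nat list" where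
  "split_ones = (\<lambda>(\<mu>, k). (hd \<mu> - k) # tl \<mu> @ replicate k 1)"

text \<open>Only the tail is searched for ones, so that a leading 1 survives as a part: the all-ones
  partition of \<open>n\<close> yields \<open>([n], n - 1)\<close>.\<close>

definition absorb_ones :: "nat list \<Rightarrow> nat list \<times> nat" where
  "absorb_ones \<mu> = (let k = count_list (tl \<mu>) 1 in ((hd \<mu> + k) # filter (\<lambda>x. x \<noteq> 1) (tl \<mu>), k))"

text \<open>The appended 1 implements the convention \<open>\<mu>\<^sub>2 = 1\<close> for a partition with a single part.\<close>

definition first_gap :: "nat list \<Rightarrow> nat" where
  "first_gap \<mu> = hd \<mu> - hd (tl \<mu> @ [1])"

lemma filter_append_ones:
  assumes "sorted_wrt (\<ge>) xs" "\<forall>x\<in>set xs. (0::nat) < x"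
  shows "filter (\<lambda>x. x \<noteq> 1) xs @ replicate (count_list xs 1) 1 = xs"
  using assms
proof (induction xs)
  case (Cons x xs)
  show ?case
  proof (cases "x = 1")
    case True
    with Cons.prems have "\<forall>y\<in>set xs. y = 1"
      by (auto simp: Suc_le_eq intro!: le_antisym)
    then have "filter (\<lambda>x. x \<noteq> 1) xs = []"
      by (simp add: filter_empty_conv)
    with True Cons show ?thesis by simp
  qed (use Cons in simp)
qed simp

lemma count_list_replicate: "count_list (replicate k x) x = k"
  by (induction k) auto

lemma absorb_split_ones:
  assumes "\<mu> \<in> nuclear_partitions n" "\<mu> \<noteq> []" "1 \<le> k" "k \<le> first_gap \<mu>"
  shows "absorb_ones (split_ones (\<mu>, k)) = (\<mu>, k)"
proof -
  from assms(2) obtain x xs where \<mu>: "\<mu> = x # xs"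
    by (cases \<mu>) auto
  have "1 \<notin> set xs" using assms(1) by (simp add: \<mu> nuclear_partitions_def)
  then have "count_list xs 1 = 0" "filter (\<lambda>x. x \<noteq> 1) xs = xs"
    by (auto intro!: filter_True)
  moreover have "k \<le> x" using assms(4) by (simp add: \<mu> first_gap_def)
  ultimately show ?thesis
    by (simp add: \<mu> absorb_ones_def split_ones_def count_list_replicate)
qed

lemma split_absorb_ones:
  assumes "\<mu> \<in> partitions n" "\<mu> \<noteq> []"
  shows "split_ones (absorb_ones \<mu>) = \<mu>"
  using assms filter_append_ones[of "tl \<mu>"]
  by (cases \<mu>) (auto simp: split_ones_def absorb_ones_def partitions_def Let_def)

lemma split_ones_partition:
  assumes "\<mu> \<in> nuclear_partitions n" "\<mu> \<noteq> []" "1 \<le> k" "k \<le> first_gap \<mu>"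
  shows "split_ones (\<mu>, k) \<in> partitions n - nuclear_partitions n"
proof -
  from assms(2) obtain x xs where \<mu>: "\<mu> = x # xs"
    by (cases \<mu>) auto
  have xs: "sorted_wrt (\<ge>) xs" "\<forall>y\<in>set xs. 0 < y" "x + sum_list xs = n"
    using assms(1) by (auto simp: \<mu> nuclear_partitions_def partitions_def)
  \<comment> \<open>As \<open>1 \<le> k\<close>, the truncated subtraction in
    \<open>first_gap\<close> is positive, hence exact, and the bound on \<open>k\<close> can be
    rearranged.\<close>
  have gap: "hd (xs @ [1]) \<le> x - k" and "k \<le> x"
    using assms(3,4) by (auto simp: \<mu> first_gap_def)
  have bound: "0 < x - k \<and> (\<forall>y\<in>set xs. y \<le> x - k)"
    using xs gap by (cases xs) auto
  have "sorted_wrt (\<ge>) (replicate k (1::nat))"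
    by (simp add: sorted_wrt_iff_nth_less)
  then show ?thesis
    using xs bound \<open>k \<le> x\<close> \<open>1 \<le> k\<close>
    by (auto simp: \<mu> split_ones_def partitions_def nuclear_partitions_def
        sorted_wrt_append sum_list_replicate Suc_le_eq)
qed

lemma absorb_ones_nuclear:
  assumes "n \<ge> 2" "\<mu> \<in> partitions n - nuclear_partitions n"
  shows "absorb_ones \<mu> \<in> (SIGMA \<mu>:nuclear_partitions n. {1..first_gap \<mu>})"
proof -
  from assms(2) obtain x xs where \<mu>: "\<mu> = x # xs"
    by (cases \<mu>) (auto simp: partitions_def nuclear_partitions_def)
  let ?ys = "filter (\<lambda>x. x \<noteq> 1) xs"
  let ?k = "count_list xs 1"
  have x: "0 < x" "\<forall>y\<in>set xs. y \<le> x" "sorted_wrt (\<ge>) xs" "\<forall>y\<in>set xs. 0 < y"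
    "x + sum_list xs = n" "x = 1 \<or> 1 \<in> set xs"
    using assms(2) by (auto simp: \<mu> partitions_def nuclear_partitions_def)
  \<comment> \<open>If the first part is 1, so are all others, and \<open>n \<ge> 2\<close> forces a
    second part.\<close>
  have "1 \<in> set xs"
  proof (cases xs)
    case Nil
    with x assms(1) show ?thesis by auto
  next
    case (Cons y ys)
    with x show ?thesis by (auto simp: Suc_le_eq)
  qed
  then have k: "0 < ?k"
    by (metis count_list_0_iff gr0I)
  have "sum_list ?ys + ?k = sum_list (?ys @ replicate ?k 1)"
    by (simp add: sum_list_replicate)
  also have "\<dots> = sum_list xs"
    using filter_append_ones[OF x(3,4)] by simp
  finally have sum: "x + ?k + sum_list ?ys = n"
    using x(5) by simp
  have "(x + ?k) # ?ys \<in> nuclear_partitions n"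
    using x k sum by (auto simp: nuclear_partitions_def partitions_def sorted_wrt_filter)
  \<comment> \<open>This gives \<open>?k \<le> first_gap\<close>: taking \<open>?k\<close> back from
    the first part leaves \<open>x\<close>, which must still dominate the next part.\<close>
  moreover have "hd (?ys @ [1]) \<le> x"
  proof (cases ?ys)
    case (Cons y ys)
    then have "y \<in> set ?ys" by simp
    then show ?thesis using x(2) Cons by simp
  qed (use x in simp)
  ultimately show ?thesis
    using k by (simp add: \<mu> absorb_ones_def first_gap_def Let_def)
qed

lemma card_non_nuclear_partitions:
  assumes "n \<ge> 2"
  shows "card (partitions n - nuclear_partitions n) = (\<Sum>\<mu>\<in>nuclear_partitions n. first_gap \<mu>)"
proof -
  have ne: "\<mu> \<noteq> []" if "\<mu> \<in> partitions n" for \<mu>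
    using that assms by (auto simp: partitions_def)
  then have ne': "\<mu> \<noteq> []" if "\<mu> \<in> nuclear_partitions n" for \<mu>
    using that by (simp add: nuclear_partitions_def)
  have "bij_betw split_ones (SIGMA \<mu>:nuclear_partitions n. {1..first_gap \<mu>})
          (partitions n - nuclear_partitions n)"
  proof (rule bij_betw_byWitness[where f' = absorb_ones])
    show "\<forall>\<mu>\<in>partitions n - nuclear_partitions n. split_ones (absorb_ones \<mu>) = \<mu>"
      using split_absorb_ones ne by blast
    show "absorb_ones ` (partitions n - nuclear_partitions n)
        \<subseteq> (SIGMA \<mu>:nuclear_partitions n. {1..first_gap \<mu>})"
      using absorb_ones_nuclear[OF assms] by (rule image_subsetI)
  qed (use ne' absorb_split_ones split_ones_partition in auto)
  from bij_betw_same_card[OF this] show ?thesis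
    by (simp add: finite_nuclear_partitions)
qed

text \<open>Only \<open>[n]\<close> has fewer than two parts here, so the appended 1 is never read,
  and the decreasing order makes the truncated subtraction exact.\<close>

lemma first_gap_nuclear:
  assumes "\<mu> \<in> nuclear_partitions n - {[n]}" "n > 0"
  shows "int (first_gap \<mu>) = int (\<mu> ! 0) - int (\<mu> ! 1)"
proof -
  from assms obtain x y xs where "\<mu> = x # y # xs" "y \<le> x"
    by (cases \<mu> rule: remdups_adj.cases) (auto simp: nuclear_partitions_def partitions_def)
  then show ?thesis by (simp add: first_gap_def)
qed

theorem theorem1:
  fixes n :: nat
  assumes "n \<ge> 2"
  shows "int (p n) = int n + int (\<nu> n) - 1
           + (\<Sum>\<mu> \<in> nuclear_partitions n - {[n]}. int (\<mu> ! 0) - int (\<mu> ! 1))"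
proof -
  have "nuclear_partitions n \<subseteq> partitions n"
    by (auto simp: nuclear_partitions_def)
  then have "p n = \<nu> n + card (partitions n - nuclear_partitions n)"
    unfolding p_def \<nu>_def
    by (simp add: card_Diff_subset card_mono finite_nuclear_partitions finite_partitions)
  also have "card (partitions n - nuclear_partitions n) = (\<Sum>\<mu>\<in>nuclear_partitions n. first_gap \<mu>)"
    by (rule card_non_nuclear_partitions[OF assms])
  \<comment> \<open>\<open>[n]\<close> is nuclear because \<open>n \<ge> 2\<close>; its gap
    \<open>n - 1\<close> comes from the convention for single parts.\<close>
  also have "\<dots> = first_gap [n] + (\<Sum>\<mu>\<in>nuclear_partitions n - {[n]}. first_gap \<mu>)"
    using assms by (intro sum.remove finite_nuclear_partitions)
      (auto simp: nuclear_partitions_def partitions_def)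
  finally have "int (p n) = int (\<nu> n) + int (first_gap [n])
      + (\<Sum>\<mu>\<in>nuclear_partitions n - {[n]}. int (first_gap \<mu>))"
    by simp
  moreover have "int (first_gap [n]) = int n - 1"
    using assms by (simp add: first_gap_def)
  moreover have "(\<Sum>\<mu>\<in>nuclear_partitions n - {[n]}. int (first_gap \<mu>)) =
      (\<Sum>\<mu>\<in>nuclear_partitions n - {[n]}. int (\<mu> ! 0) - int (\<mu> ! 1))"
    using assms by (intro sum.cong first_gap_nuclear) auto
  ultimately show ?thesis by simp
qed

end
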